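(* Let $L$ be a multiset of even integers greater than $2$. If $\epsilon\ge(2|L|+3)(\max(L)+3)$, then there is a graceful labeling $\Gamma$ of $\left[L,2\ \middle|\ \epsilon-\sum_{\ell\in L}\ell-2\right]$ such that $\Delta_p\Gamma\supseteq\mathcal{I}\big((2|L|+1)(\max(L)+3)+1,\,\epsilon\big)$.
   Context: $\mathcal{I}(a,b)=\{x\in\mathbb{Z}\mid a\le x\le b\}$; $|L|$ counts multiplicity; the maximum of an empty multiset is $0$. $[L,2\mid m]$ is the vertex-disjoint union of one $\ell$-cycle for each $\ell\in L$, one $2$-cycle (two vertices joined by two parallel edges), and a path with $m$ edges; its number of edges is $\epsilon=\sum_{\ell\in L}\ell+2+m$. A labeling is an isomorphic copy with distinct integer vertices; $\Delta\Gamma$ is the multiset of differences $x-y$ over ordered pairs of adjacent vertices (parallel edges counted separately), and $\Delta_p\Gamma$ is the same restricted to edges of the path. A graceful labeling of such a graph (with exactly one $2$-cycle) is a labeling $\Gamma$ with vertex set $\mathcal{I}(0,\epsilon)$ and $\Delta\Gamma=\pm\{1,3,3\}\cup\pm\mathcal{I}(4,\epsilon)$ as multisets. *)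

theory Defs
  imports Complex_Main "HOL-Library.Multiset"
begin

text \<open>Loopless multigraphs: an edge is the set of its two end vertices, and parallel edges are
  repeated elements of the edge multiset.\<close>

record 'v multigraph =
  verts :: "'v set"
  edges :: "'v set multiset"

definition isomorphism :: "('v \<Rightarrow> 'w) \<Rightarrow> 'v multigraph \<Rightarrow> 'w multigraph \<Rightarrow> bool" where
  "isomorphism f G H \<longleftrightarrow>
     bij_betw f (verts G) (verts H) \<and> edges H = image_mset (image f) (edges G)"

text \<open>\<open>Cyc l i j\<close> is the \<open>j\<close>-th vertex of the \<open>i\<close>-th copy of the \<open>l\<close>-cycle, and \<open>Pth j\<close> is the
  \<open>j\<close>-th vertex of the path.\<close>

datatype vertex = Cyc nat nat nat | Pth nat

text \<open>For \<open>l = 2\<close> the two values of \<open>j\<close> give the same vertex pair, so this multiset consists of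
  two parallel edges.\<close>

definition cycle_edges :: "(nat \<Rightarrow> 'v) \<Rightarrow> nat \<Rightarrow> 'v set multiset" where
  "cycle_edges v l = image_mset (\<lambda>j. {v j, v (Suc j mod l)}) (mset_set {..<l})"

definition path_edges :: "(nat \<Rightarrow> 'v) \<Rightarrow> nat \<Rightarrow> 'v set multiset" where
  "path_edges v m = image_mset (\<lambda>j. {v j, v (Suc j)}) (mset_set {..<m})"

text \<open>The graph \<open>[M | m]\<close>, for a multiset \<open>M\<close> of integers that are at least 2;
  thus \<open>[L, 2 | m]\<close> is \<open>cycles_path (add_mset 2 L) m\<close>.\<close>

definition cycles_path :: "nat multiset \<Rightarrow> nat \<Rightarrow> vertex multigraph" where
  "cycles_path M m =
     \<lparr> verts = {Cyc l i j | l i j. i < count M l \<and> j < l} \<union> Pth ` {..m},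
       edges = (\<Sum>l\<in>set_mset M. \<Sum>i<count M l. cycle_edges (Cyc l i) l) + path_edges Pth m \<rparr>"

text \<open>Both ordered pairs of ends of every edge contribute.\<close>

definition Delta :: "int set multiset \<Rightarrow> int multiset" where
  "Delta E = (\<Sum>e\<in>#E. image_mset (\<lambda>(x, y). x - y) (mset_set {(x, y). {x, y} = e}))"

definition plus_minus :: "int multiset \<Rightarrow> int multiset" where
  "plus_minus D = D + image_mset uminus D"

text \<open>The labeling \<open>\<Gamma>\<close> comes with an isomorphism \<open>f\<close> from \<open>G\<close>, which tells which edges of \<open>\<Gamma>\<close>
  are those of the path. The difference condition is the one for graphs \<open>G\<close> with exactly one
  2-cycle.\<close>

definition graceful_labeling ::
    "(vertex \<Rightarrow> int) \<Rightarrow> vertex multigraph \<Rightarrow> int multigraph \<Rightarrow> bool" where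
  "graceful_labeling f G \<Gamma> \<longleftrightarrow>
     isomorphism f G \<Gamma> \<and>
     verts \<Gamma> = {0..int (size (edges \<Gamma>))} \<and>
     Delta (edges \<Gamma>) =
       plus_minus {#1, 3, 3#} + plus_minus (mset_set {4..int (size (edges \<Gamma>))})"

text \<open>\<open>\<Delta>\<^sub>p \<Gamma>\<close>. The path is the only component that is not a cycle, so this does not depend on the
  choice of the isomorphism \<open>f\<close> onto \<open>\<Gamma>\<close>.\<close>

definition Delta_path :: "(vertex \<Rightarrow> int) \<Rightarrow> nat \<Rightarrow> int multiset" where
  "Delta_path f m = Delta (image_mset (image f) (path_edges Pth m))"

definition max_or_0 :: "nat multiset \<Rightarrow> nat" where
  "max_or_0 L = (if L = {#} then 0 else Max (set_mset L))"

end

theory Submission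
  imports Defs
begin

text \<open>Call a graceful labeling with vertex set \<open>{0..e}\<close> good if the path ends at the label 1.
  For \<open>e = 3\<close> the 2-cycle on \<open>{0, 3}\<close> and the path \<open>2, 1\<close> are good. A good labeling is enlarged by
  adding labels below 0 and above \<open>e\<close> and prolonging the path, so that the new differences are
  exactly the next ones \<open>e + 1, e + 2, \<dots>\<close> and the path ends at distance 1 from the end of the new
  interval; a translation or a reflection makes the result good again. There are three such moves:
  prolonging the path by 3 edges; prolonging it by 4 edges; and adding a cycle of length
  \<open>2h \<ge> 4\<close> together with \<open>h - 1\<close> path edges, which raises \<open>e\<close> by \<open>3h - 1\<close>. In the last move the
  path and the two halves of the cycle zigzag in parallel between low and high labels, each of
  them using the differences in one class modulo 3, up to boundary effects. After all cycles have
  been added, \<open>e\<close> is at most \<open>(2|L| + 1)(max(L) + 3)\<close>, so at least 6 differences remain,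
  and every number that is at least 6 is a sum of 3s and 4s: the path takes all of them.\<close>

section \<open>Differences and isomorphic copies\<close>

lemma Delta_add: "Delta (A + B) = Delta A + Delta B"
  by (simp add: Delta_def)

lemma plus_minus_add: "plus_minus (A + B) = plus_minus A + plus_minus B"
  by (simp add: plus_minus_def)

text \<open>An edge with two distinct ends has exactly two orderings, and their differences are
  opposite. A loop would have only one ordering and yield a single 0, whereas
  \<open>plus_minus\<close> yields two; hence the assumption.\<close>

lemma Delta_edges:
  assumes "\<And>j. j \<in># A \<Longrightarrow> u j \<noteq> w j"
  shows "Delta (image_mset (\<lambda>j. {u j, w j}) A) = plus_minus (image_mset (\<lambda>j. \<bar>u j - w j\<bar>) A)"
  using assms
proof (induction A)
  case empty
  then show ?case by (simp add: Delta_def plus_minus_def)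
next
  case (add k A)
  have ne: "u k \<noteq> w k" using add.prems by simp
  have "{(x, y). {x, y} = {u k, w k}} = {(u k, w k), (w k, u k)}"
    by (auto simp: doubleton_eq_iff)
  with ne have "Delta {#{u k, w k}#} = {#u k - w k, w k - u k#}"
    by (simp add: Delta_def)
  also have "\<dots> = plus_minus {#\<bar>u k - w k\<bar>#}"
    using ne by (cases "u k < w k") (auto simp: plus_minus_def abs_if add_mset_commute)
  finally show ?case
    using add Delta_add[of "{#{u k, w k}#}" "image_mset (\<lambda>j. {u j, w j}) A"]
      plus_minus_add[of "{#\<bar>u k - w k\<bar>#}" "image_mset (\<lambda>j. \<bar>u j - w j\<bar>) A"]
    by simp
qed

text \<open>Equal supports give surjectivity, equal sizes give \<open>card V = card I\<close>, and a
  surjection between finite sets of equal size is injective. Labels can thus be tracked additively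
  as multisets, and their distinctness is recovered at the very end.\<close>

lemma bij_betw_if_image_mset:
  assumes "finite V" "finite I" "image_mset f (mset_set V) = mset_set I"
  shows "bij_betw f V I"
proof -
  have "f ` V = I"
    using arg_cong[OF assms(3), of set_mset] assms(1,2) by simp
  moreover have "card V = card I"
    using arg_cong[OF assms(3), of size] by simp
  ultimately show ?thesis
    using eq_card_imp_inj_on[OF assms(1)] by (auto simp: bij_betw_def)
qed

section \<open>The graph after one more cycle\<close>

lemma edges_add_cycle:
  "edges (cycles_path (add_mset l M) m) =
     edges (cycles_path M m) + cycle_edges (Cyc l (count M l)) l"
proof -
  define g where "g N k = (\<Sum>i<count N k. cycle_edges (Cyc k i) k)" for N k
  have "(\<Sum>k\<in>set_mset (add_mset l M). g (add_mset l M) k) =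
      g (add_mset l M) l + (\<Sum>k\<in>set_mset M - {l}. g (add_mset l M) k)"
    by (simp add: sum.insert_remove)
  also have "(\<Sum>k\<in>set_mset M - {l}. g (add_mset l M) k) = (\<Sum>k\<in>set_mset M - {l}. g M k)"
    by (rule sum.cong) (auto simp: g_def)
  also have "g (add_mset l M) l = g M l + cycle_edges (Cyc l (count M l)) l"
    by (simp add: g_def)
  also have "g M l + cycle_edges (Cyc l (count M l)) l + (\<Sum>k\<in>set_mset M - {l}. g M k) =
      (\<Sum>k\<in>insert l (set_mset M). g M k) + cycle_edges (Cyc l (count M l)) l"
    by (simp add: sum.insert_remove)
  \<comment> \<open>If \<open>l\<close> does not occur in \<open>M\<close>, its summand
    \<open>g M l\<close> is an empty sum.\<close>
  also have "(\<Sum>k\<in>insert l (set_mset M). g M k) = (\<Sum>k\<in>set_mset M. g M k)"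
    by (rule sum.mono_neutral_right) (auto simp: g_def not_in_iff)
  finally show ?thesis
    by (simp add: cycles_path_def g_def)
qed

lemma size_edges: "size (edges (cycles_path M m)) = sum_mset M + m"
proof (induction M)
  case empty
  then show ?case by (simp add: cycles_path_def path_edges_def)
next
  case (add l M)
  then show ?case by (simp add: edges_add_cycle cycle_edges_def)
qed

lemma verts_add_cycle:
  "verts (cycles_path (add_mset l M) m) =
     verts (cycles_path M m) \<union> Cyc l (count M l) ` {..<l}"
  by (auto simp: cycles_path_def less_Suc_eq split: if_splits)

lemma finite_verts: "finite (verts (cycles_path M m))"
proof (induction M)
  case empty
  then show ?case by (simp add: cycles_path_def)
next
  case (add l M)
  then show ?case by (simp add: verts_add_cycle)
qed

lemma edge_subset_verts: "e \<in># edges (cycles_path M m) \<Longrightarrow> e \<subseteq> verts (cycles_path M m)"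
proof (induction M)
  case empty
  then show ?case by (auto simp: cycles_path_def path_edges_def)
next
  case (add l M)
  have "{Cyc l (count M l) j, Cyc l (count M l) (Suc j mod l)} \<subseteq> Cyc l (count M l) ` {..<l}"
    if "j < l" for j
    using that by (cases l) auto
  with add show ?case
    by (auto simp: edges_add_cycle verts_add_cycle cycle_edges_def)
qed

section \<open>Labelings with prescribed labels and differences\<close>

text \<open>\<open>I\<close> is the multiset of labels; \<open>D\<close> and \<open>P\<close> are the absolute differences along all edges
  and along the path edges.\<close>

definition labels ::
    "(vertex \<Rightarrow> int) \<Rightarrow> nat multiset \<Rightarrow> nat \<Rightarrow> int multiset \<Rightarrow> int multiset \<Rightarrow> int multiset \<Rightarrow> bool" where
  "labels f M m I D P \<longleftrightarrow>
     image_mset f (mset_set (verts (cycles_path M m))) = I \<and>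
     Delta (image_mset (image f) (edges (cycles_path M m))) = plus_minus D \<and>
     Delta_path f m = plus_minus P"

lemma labels_add_cycle:
  assumes f: "labels f M m I D P"
    and ne: "\<And>j. j < l \<Longrightarrow> C j \<noteq> C (Suc j mod l)"
  obtains f' where "labels f' (add_mset l M) m (I + image_mset C (mset_set {..<l}))
      (D + image_mset (\<lambda>j. \<bar>C j - C (Suc j mod l)\<bar>) (mset_set {..<l})) P"
    and "\<And>j. f' (Pth j) = f (Pth j)"
proof
  define f' where "f' v = (case v of
    Cyc k i j \<Rightarrow> if k = l \<and> i = count M l then C j else f v | Pth j \<Rightarrow> f v)" for v
  let ?V = "verts (cycles_path M m)" and ?E = "edges (cycles_path M m)"
  let ?c = "Cyc l (count M l)"
  have old: "f' v = f v" if "v \<in> ?V" for v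
    using that by (auto simp: f'_def cycles_path_def)
  have new: "f' (?c j) = C j" for j
    by (simp add: f'_def)
  have disj: "?V \<inter> ?c ` {..<l} = {}"
    by (auto simp: cycles_path_def)
  have "mset_set (verts (cycles_path (add_mset l M) m)) =
      mset_set ?V + image_mset ?c (mset_set {..<l})"
    unfolding verts_add_cycle
    by (subst mset_set_Union) (auto simp: finite_verts disj image_mset_mset_set inj_on_def)
  moreover have "image_mset f' (mset_set ?V) = image_mset f (mset_set ?V)"
    by (rule image_mset_cong) (simp add: old finite_verts)
  ultimately have V: "image_mset f' (mset_set (verts (cycles_path (add_mset l M) m))) =
      I + image_mset C (mset_set {..<l})"
    using f by (simp add: labels_def multiset.map_comp o_def new)
  have "image_mset (image f') ?E = image_mset (image f) ?E"
  proof (rule image_mset_cong)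
    fix e assume "e \<in># ?E"
    from edge_subset_verts[OF this] show "f' ` e = f ` e"
      by (intro image_cong) (auto simp: old)
  qed
  moreover have "image_mset (image f') (cycle_edges ?c l) =
      image_mset (\<lambda>j. {C j, C (Suc j mod l)}) (mset_set {..<l})"
    by (simp add: cycle_edges_def multiset.map_comp o_def new)
  moreover have "Delta (image_mset (\<lambda>j. {C j, C (Suc j mod l)}) (mset_set {..<l})) =
      plus_minus (image_mset (\<lambda>j. \<bar>C j - C (Suc j mod l)\<bar>) (mset_set {..<l}))"
    by (rule Delta_edges) (simp add: ne)
  ultimately have E: "Delta (image_mset (image f') (edges (cycles_path (add_mset l M) m))) =
      plus_minus (D + image_mset (\<lambda>j. \<bar>C j - C (Suc j mod l)\<bar>) (mset_set {..<l}))"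
    using f by (simp add: labels_def edges_add_cycle Delta_add plus_minus_add)
  have "Delta_path f' m = Delta_path f m"
    by (simp add: Delta_path_def path_edges_def multiset.map_comp o_def f'_def)
  with V E f show "labels f' (add_mset l M) m (I + image_mset C (mset_set {..<l}))
      (D + image_mset (\<lambda>j. \<bar>C j - C (Suc j mod l)\<bar>) (mset_set {..<l})) P"
    by (simp add: labels_def)
  show "f' (Pth j) = f (Pth j)" for j
    by (simp add: f'_def)
qed

lemma path_edges_extend:
  "path_edges v (m + t) = path_edges v m + path_edges (\<lambda>j. v (m + j)) t"
  by (induction t) (simp_all add: path_edges_def lessThan_Suc)

lemma image_mset_path_edges:
  "image_mset (image f) (path_edges v m) = path_edges (\<lambda>j. f (v j)) m"
  by (simp add: path_edges_def multiset.map_comp o_def)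

lemma edges_cycles_path_extend:
  "edges (cycles_path M (m + t)) = edges (cycles_path M m) + path_edges (\<lambda>j. Pth (m + j)) t"
  by (simp add: cycles_path_def path_edges_extend)

lemma verts_cycles_path_extend:
  "verts (cycles_path M (m + t)) = verts (cycles_path M m) \<union> (\<lambda>j. Pth (m + j)) ` {Suc 0..t}"
proof -
  have "{..m + t} = {..m} \<union> (+) m ` {Suc 0..t}"
    by (auto simp: image_add_atLeastAtMost)
  then have "Pth ` {..m + t} = Pth ` {..m} \<union> (\<lambda>j. Pth (m + j)) ` {Suc 0..t}"
    by (simp only: image_Un image_image)
  then show ?thesis
    by (simp add: cycles_path_def Un_assoc)
qed

lemma labels_extend_path:
  assumes f: "labels f M m I D P"
    and p0: "p 0 = f (Pth m)"
    and ne: "\<And>j. j < t \<Longrightarrow> p j \<noteq> p (Suc j)"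
  defines "X \<equiv> image_mset (\<lambda>j. \<bar>p j - p (Suc j)\<bar>) (mset_set {..<t})"
  obtains f' where "labels f' M (m + t) (I + image_mset p (mset_set {Suc 0..t})) (D + X) (P + X)"
    and "f' (Pth (m + t)) = p t"
proof
  define f' where "f' v = (case v of
    Pth j \<Rightarrow> if j \<le> m then f v else p (j - m) | Cyc k i j \<Rightarrow> f v)" for v
  let ?V = "verts (cycles_path M m)" and ?E = "edges (cycles_path M m)"
  have old: "f' v = f v" if "v \<in> ?V" for v
    using that by (auto simp: f'_def cycles_path_def)
  \<comment> \<open>For \<open>j = 0\<close> this is the assumption on \<open>p 0\<close>: the old
    end is the start of the first new edge, so there are \<open>t\<close> new differences and the
    new labels are \<open>p 1\<close> to \<open>p t\<close>.\<close>
  have new: "f' (Pth (m + j)) = p j" for j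
    using p0 by (cases j) (simp_all add: f'_def)
  have disj: "?V \<inter> (\<lambda>j. Pth (m + j)) ` {Suc 0..t} = {}"
    by (auto simp: cycles_path_def)
  have "mset_set (verts (cycles_path M (m + t))) =
      mset_set ?V + image_mset (\<lambda>j. Pth (m + j)) (mset_set {Suc 0..t})"
    unfolding verts_cycles_path_extend
    by (subst mset_set_Union) (simp_all add: finite_verts disj image_mset_mset_set inj_on_def)
  moreover have "image_mset f' (mset_set ?V) = image_mset f (mset_set ?V)"
    by (rule image_mset_cong) (simp add: old finite_verts)
  ultimately have V: "image_mset f' (mset_set (verts (cycles_path M (m + t)))) =
      I + image_mset p (mset_set {Suc 0..t})"
    using f by (simp add: labels_def multiset.map_comp o_def new)
  have X: "Delta (path_edges p t) = plus_minus X"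
    unfolding path_edges_def X_def by (rule Delta_edges) (simp add: ne)
  have "image_mset (image f') ?E = image_mset (image f) ?E"
  proof (rule image_mset_cong)
    fix e assume "e \<in># ?E"
    from edge_subset_verts[OF this] show "f' ` e = f ` e"
      by (intro image_cong) (auto simp: old)
  qed
  with f X have E: "Delta (image_mset (image f') (edges (cycles_path M (m + t)))) =
      plus_minus (D + X)"
    by (simp add: labels_def edges_cycles_path_extend Delta_add plus_minus_add
      image_mset_path_edges new)
  have "path_edges (\<lambda>j. f' (Pth j)) m = path_edges (\<lambda>j. f (Pth j)) m"
    by (auto simp: path_edges_def f'_def intro!: image_mset_cong)
  with f X have "Delta_path f' (m + t) = plus_minus (P + X)"
    by (simp add: labels_def Delta_path_def image_mset_path_edges path_edges_extend[of _ m t]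
      Delta_add plus_minus_add new)
  with V E show "labels f' M (m + t) (I + image_mset p (mset_set {Suc 0..t})) (D + X) (P + X)"
    by (simp add: labels_def)
  show "f' (Pth (m + t)) = p t"
    by (rule new)
qed

section \<open>Translations and reflections\<close>

lemma Delta_image_affine:
  fixes s c :: int
  assumes "s = 1 \<or> s = -1" and g: "\<And>x. g x = c + s * x"
  shows "Delta (image_mset (image g) E) = image_mset ((*) s) (Delta E)"
proof (induction E)
  case empty
  then show ?case by (simp add: Delta_def)
next
  case (add e E)
  have inj: "inj g" using assms by (auto simp: inj_on_def)
  \<comment> \<open>The inverse uses \<open>s * s = 1\<close>.\<close>
  have surj: "\<exists>z. x = g z" for x
    using assms by (intro exI[of _ "s * (x - c)"]) auto
  have "bij_betw (map_prod g g) {(x, y). {x, y} = e} {(x, y). {x, y} = g ` e}"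
  proof (rule bij_betwI')
    fix p q :: "int \<times> int"
    show "(map_prod g g p = map_prod g g q) = (p = q)"
      by (cases p; cases q) (simp add: inj_eq[OF inj])
  next
    fix p :: "int \<times> int" assume "p \<in> {(x, y). {x, y} = e}"
    then show "map_prod g g p \<in> {(x, y). {x, y} = g ` e}" by auto
  next
    fix q :: "int \<times> int" assume q: "q \<in> {(x, y). {x, y} = g ` e}"
    obtain x y where xy: "fst q = g x" "snd q = g y"
      using surj[of "fst q"] surj[of "snd q"] by blast
    with q have "g ` {x, y} = g ` e" by (auto simp: case_prod_unfold)
    with inj have "{x, y} = e" by (simp only: inj_image_eq_iff)
    with xy show "\<exists>p\<in>{(x, y). {x, y} = e}. q = map_prod g g p"
      by (intro bexI[of _ "(x, y)"]) (simp_all add: prod_eq_iff)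
  qed
  then have "mset_set {(x, y). {x, y} = g ` e} =
      image_mset (map_prod g g) (mset_set {(x, y). {x, y} = e})"
    by (metis bij_betw_def image_mset_mset_set)
  then have "Delta {#g ` e#} = image_mset ((*) s) (Delta {#e#})"
    by (simp add: Delta_def multiset.map_comp o_def case_prod_unfold g algebra_simps)
  with add show ?case
    using Delta_add[of "{#g ` e#}" "image_mset (image g) E"] Delta_add[of "{#e#}" E] by simp
qed

lemma image_mset_times_plus_minus:
  fixes s :: int
  assumes "s = 1 \<or> s = -1"
  shows "image_mset ((*) s) (plus_minus D) = plus_minus D"
proof -
  have "(*) s = (\<lambda>x. x) \<or> (*) s = uminus"
    using assms by auto
  then show ?thesis
    by (auto simp: plus_minus_def multiset.map_comp o_def)
qed

text \<open>A translation preserves differences and a reflection negates them, which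
  \<open>plus_minus\<close> does not notice. Hence \<open>D\<close> and \<open>P\<close> stay the
  same and only the labels move.\<close>

lemma labels_affine:
  assumes "labels f M m I D P" "s = 1 \<or> s = -1"
  shows "labels (\<lambda>v. c + s * f v) M m (image_mset (\<lambda>x. c + s * x) I) D P"
proof -
  have image: "image_mset (image (\<lambda>v. c + s * f v)) E =
      image_mset (image (\<lambda>x. c + s * x)) (image_mset (image f) E)" for E
    by (simp add: multiset.map_comp o_def image_image)
  have "Delta (image_mset (image (\<lambda>v. c + s * f v)) E) = plus_minus X"
    if "Delta (image_mset (image f) E) = plus_minus X" for E X
    unfolding image Delta_image_affine[OF assms(2) refl] that image_mset_times_plus_minus[OF assms(2)] ..
  with assms show ?thesis
    by (auto simp: labels_def Delta_path_def multiset.map_comp o_def)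
qed

section \<open>Enlarging a good labeling\<close>

text \<open>This is the good labeling of the overview, with the 2-cycle kept apart from
  \<open>L\<close>. The parameter \<open>P\<close> is left free in order to record which absolute
  differences the path has collected.\<close>

definition end_at_one :: "(vertex \<Rightarrow> int) \<Rightarrow> nat multiset \<Rightarrow> nat \<Rightarrow> nat \<Rightarrow> int multiset \<Rightarrow> bool" where
  "end_at_one f L m e P \<longleftrightarrow> e = sum_mset L + 2 + m \<and> 3 \<le> e \<and> f (Pth m) = 1 \<and>
     labels f (add_mset 2 L) m (mset_set {0..int e}) ({#1, 3, 3#} + mset_set {4..int e}) P"

lemma mset_set_ivl_append:
  "x \<le> y + 1 \<Longrightarrow> y \<le> z \<Longrightarrow> y' = y + 1 \<Longrightarrow> mset_set {x..y} + mset_set {y'..z} = mset_set {x..z}"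
  for x y z :: int
  by (subst mset_set_Union[symmetric]) (auto intro!: arg_cong[where f = mset_set])

lemma mset_set_ivl_snoc:
  "x \<le> y + 1 \<Longrightarrow> y' = y + 1 \<Longrightarrow> mset_set {x..y'} = add_mset y' (mset_set {x..y})" for x y y' :: int
  using mset_set_ivl_append[of x y y' y'] by simp

lemma mset_set_ivl_cons:
  "x \<le> y + 1 \<Longrightarrow> x' = x - 1 \<Longrightarrow> mset_set {x'..y} = add_mset x' (mset_set {x..y})" for x x' y :: int
  using mset_set_ivl_append[of "x - 1" "x - 1" y x] by simp

text \<open>The old and new labels together fill the interval from \<open>-a\<close> to
  \<open>b\<close>. If the path ends at \<open>1 - a\<close>, translation by \<open>a\<close> sends
  that end to 1; if it ends at \<open>b - 1\<close>, the reflection \<open>b - x\<close> does.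
  Either map carries the interval onto \<open>{0..int e'}\<close>.\<close>

lemma end_at_one_normalize:
  assumes f: "labels f (add_mset 2 L) m
      (mset_set {0..int e} + (mset_set {-a..-1} + mset_set {int e + 1..b}))
      ({#1, 3, 3#} + mset_set {4..int e} + mset_set {int e + 1..int e'}) P"
    and ab: "0 \<le> a" "int e \<le> b"
    and e: "3 \<le> e" "e \<le> e'" "int e' = a + b" "e' = sum_mset L + 2 + m"
    and endpoint: "f (Pth m) = 1 - a \<or> f (Pth m) = b - 1"
  obtains f' where "end_at_one f' L m e' P"
proof -
  have "mset_set {0..int e} + (mset_set {-a..-1} + mset_set {int e + 1..b}) =
      mset_set {-a..-1} + mset_set {0..int e} + mset_set {int e + 1..b}"
    by simp
  also have "mset_set {-a..-1} + mset_set {0..int e} = mset_set {-a..int e}"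
    using ab by (intro mset_set_ivl_append) auto
  also have "mset_set {-a..int e} + mset_set {int e + 1..b} = mset_set {-a..b}"
    using ab by (intro mset_set_ivl_append) auto
  finally have I: "mset_set {0..int e} + (mset_set {-a..-1} + mset_set {int e + 1..b}) =
      mset_set {-a..b}" .
  have le: "int e \<le> int e'" using e(2) by simp
  have D: "{#1, 3, 3#} + mset_set {4..int e} + mset_set {int e + 1..int e'} =
      {#1, 3, 3#} + mset_set {4..int e'}"
    unfolding add.assoc using e(1) le by (subst mset_set_ivl_append) auto
  obtain s c :: int where s: "s = 1 \<or> s = -1" and "c + s * f (Pth m) = 1"
    and bij: "bij_betw (\<lambda>x. c + s * x) {-a..b} {0..int e'}"
  proof (cases "f (Pth m) = 1 - a")
    case True
    moreover have "bij_betw (\<lambda>x. a + 1 * x) {-a..b} {0..int e'}"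
      by (rule bij_betw_byWitness[where f' = "\<lambda>x. x - a"]) (auto simp: e(3))
    ultimately show ?thesis using that[of 1 a] by simp
  next
    case False
    with endpoint have "f (Pth m) = b - 1" by simp
    moreover have "bij_betw (\<lambda>x. b + -1 * x) {-a..b} {0..int e'}"
      by (rule bij_betw_byWitness[where f' = "\<lambda>x. b - x"]) (auto simp: e(3))
    ultimately show ?thesis using that[of "-1" b] by simp
  qed
  have "image_mset (\<lambda>x. c + s * x) (mset_set {-a..b}) = mset_set {0..int e'}"
    using bij by (metis bij_betw_def image_mset_mset_set)
  then have "labels (\<lambda>v. c + s * f v) (add_mset 2 L) m (mset_set {0..int e'})
      ({#1, 3, 3#} + mset_set {4..int e'}) P"
    using labels_affine[OF f s, of c] unfolding I D by simp
  moreover have "3 \<le> e'"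
    using e(1,2) by simp
  ultimately show ?thesis
    using \<open>c + s * f (Pth m) = 1\<close> e(4) by (intro that[of "\<lambda>v. c + s * f v"]) (simp only: end_at_one_def)
qed

lemma end_at_one_start: obtains f P where "end_at_one f {#} 1 3 P"
proof -
  \<comment> \<open>The construction begins with a one-vertex path labelled 2; the 2-cycle on 0 and
    3 and then the edge from 2 to 1 are added by the general lemmas.\<close>
  have "labels (\<lambda>_. 2) {#} 0 {#2#} {#} {#}"
    by (simp add: labels_def cycles_path_def path_edges_def Delta_def plus_minus_def Delta_path_def)
  moreover have "3 * int j \<noteq> 3 * int (Suc j mod 2)" if "j < 2" for j
    using that by (auto simp: less_2_cases_iff)
  ultimately obtain f where f: "labels f {#2#} 0 {#2, 0, 3#} {#3, 3#} {#}" "f (Pth 0) = 2"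
    by (rule labels_add_cycle[where l = 2 and C = "\<lambda>j. 3 * int j"])
      (auto simp: lessThan_Suc eval_nat_numeral add_mset_commute)
  obtain f' where "labels f' {#2#} (0 + 1) ({#2, 0, 3#} + {#1#}) ({#3, 3#} + {#1#}) ({#} + {#1#})"
    and "f' (Pth (0 + 1)) = 1"
    by (rule labels_extend_path[OF f(1), where p = "\<lambda>k. 2 - int k" and t = 1])
      (use f(2) in \<open>auto simp: lessThan_Suc\<close>)
  moreover have "{0..3::int} = {0, 1, 2, 3}" by auto
  ultimately show ?thesis
    by (intro that) (simp add: end_at_one_def add_mset_commute)
qed

text \<open>Every element of the interval is at least \<open>int e + 1\<close>, hence positive.
  Computing the new differences therefore already shows that no new edge is a loop.\<close>

lemma consecutive_distinct:
  fixes u w :: "'a \<Rightarrow> int"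
  assumes "image_mset (\<lambda>j. \<bar>u j - w j\<bar>) A \<subseteq># mset_set {int e + 1..c}" "j \<in># A"
  shows "u j \<noteq> w j"
proof -
  have "\<bar>u j - w j\<bar> \<in># image_mset (\<lambda>j. \<bar>u j - w j\<bar>) A"
    using assms(2) by auto
  with assms(1) have "\<bar>u j - w j\<bar> \<in># mset_set {int e + 1..c}"
    by (rule mset_subset_eqD)
  then show ?thesis by auto
qed

section \<open>Moves that only prolong the path\<close>

lemma end_at_one_extend_path:
  fixes a b :: int
  assumes f: "end_at_one f L m e P"
    and p0: "p 0 = 1"
    and endpoint: "p t = 1 - a \<or> p t = b - 1"
    and ab: "0 \<le> a" "int e \<le> b" "a + b = int (e + t)"
    and verts: "image_mset p (mset_set {Suc 0..t}) = mset_set {-a..-1} + mset_set {int e + 1..b}"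
    and diffs: "image_mset (\<lambda>j. \<bar>p j - p (Suc j)\<bar>) (mset_set {..<t}) =
      mset_set {int e + 1..int (e + t)}"
  obtains f' where "end_at_one f' L (m + t) (e + t) (P + mset_set {int e + 1..int (e + t)})"
proof -
  have ne: "p j \<noteq> p (Suc j)" if "j < t" for j
    using consecutive_distinct[of p "\<lambda>j. p (Suc j)" "mset_set {..<t}" e "int (e + t)" j] that
    by (simp add: diffs)
  have labels: "labels f (add_mset 2 L) m (mset_set {0..int e})
      ({#1, 3, 3#} + mset_set {4..int e}) P" and p0': "p 0 = f (Pth m)"
    using f p0 unfolding end_at_one_def by metis+
  obtain f' where f': "labels f' (add_mset 2 L) (m + t)
      (mset_set {0..int e} + (mset_set {-a..-1} + mset_set {int e + 1..b}))
      ({#1, 3, 3#} + mset_set {4..int e} + mset_set {int e + 1..int (e + t)})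
      (P + mset_set {int e + 1..int (e + t)})" "f' (Pth (m + t)) = p t"
    using labels_extend_path[where t = t, OF labels p0' ne] unfolding verts diffs by blast
  show ?thesis
  proof (rule end_at_one_normalize[OF f'(1) ab(1,2)])
    show "3 \<le> e" "e + t = sum_mset L + 2 + (m + t)"
      using f by (simp_all add: end_at_one_def)
    show "f' (Pth (m + t)) = 1 - a \<or> f' (Pth (m + t)) = b - 1"
      using endpoint f'(2) by simp
  qed (use ab that in auto)
qed

text \<open>The path continues 1, \<open>e + 2\<close>, -1, \<open>e + 1\<close> with differences
  \<open>e + 1\<close>, \<open>e + 3\<close>, \<open>e + 2\<close>. Here \<open>a = 1\<close> and
  \<open>b = e + 2\<close>, and the path ends at \<open>b - 1\<close>.\<close>

lemma end_at_one_extend3: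
  assumes "end_at_one f L m e P"
  shows "\<exists>f'. end_at_one f' L (m + 3) (e + 3) (P + mset_set {int e + 1..int (e + 3)})"
proof -
  let ?p = "\<lambda>k. [1, int e + 2, -1, int e + 1] ! k"
  have "image_mset ?p (mset_set {Suc 0..3}) = {#-1, int e + 1, int e + 2#}"
    by (simp add: eval_nat_numeral atLeastAtMostSuc_conv add_mset_commute)
  also have "{int e + 1..int e + 2} = {int e + 1, int e + 2}" by auto
  then have "{#-1, int e + 1, int e + 2#} = mset_set {-1..-1} + mset_set {int e + 1..int e + 2}"
    by simp
  finally have verts: "image_mset ?p (mset_set {Suc 0..3}) =
      mset_set {-1..-1} + mset_set {int e + 1..int e + 2}" .
  have "image_mset (\<lambda>j. \<bar>?p j - ?p (Suc j)\<bar>) (mset_set {..<3}) =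
      {#int e + 1, int e + 2, int e + 3#}"
    by (simp add: eval_nat_numeral lessThan_Suc add_mset_commute add.commute)
  also have "{int e + 1..int (e + 3)} = {int e + 1, int e + 2, int e + 3}" by auto
  then have "{#int e + 1, int e + 2, int e + 3#} = mset_set {int e + 1..int (e + 3)}"
    by simp
  finally have diffs: "image_mset (\<lambda>j. \<bar>?p j - ?p (Suc j)\<bar>) (mset_set {..<3}) =
      mset_set {int e + 1..int (e + 3)}" .
  show ?thesis
    using end_at_one_extend_path[OF assms _ _ _ _ _ verts diffs] by auto
qed

text \<open>The path continues 1, \<open>e + 2\<close>, -2, \<open>e + 1\<close>, -1 with
  differences \<open>e + 1\<close>, \<open>e + 4\<close>, \<open>e + 3\<close>,
  \<open>e + 2\<close>. Here \<open>a = 2\<close> and \<open>b = e + 2\<close>, and the path ends at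
  \<open>1 - a\<close>.\<close>

lemma end_at_one_extend4:
  assumes "end_at_one f L m e P"
  shows "\<exists>f'. end_at_one f' L (m + 4) (e + 4) (P + mset_set {int e + 1..int (e + 4)})"
proof -
  let ?p = "\<lambda>k. [1, int e + 2, -2, int e + 1, -1] ! k"
  have "image_mset ?p (mset_set {Suc 0..4}) = {#-2, -1, int e + 1, int e + 2#}"
    by (simp add: eval_nat_numeral atLeastAtMostSuc_conv add_mset_commute)
  also have "{int e + 1..int e + 2} = {int e + 1, int e + 2}" "{-2..-1::int} = {-2, -1}" by auto
  then have "{#-2, -1, int e + 1, int e + 2#} =
      mset_set {-2..-1} + mset_set {int e + 1..int e + 2}"
    by simp
  finally have verts: "image_mset ?p (mset_set {Suc 0..4}) =
      mset_set {-2..-1} + mset_set {int e + 1..int e + 2}" .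
  have "image_mset (\<lambda>j. \<bar>?p j - ?p (Suc j)\<bar>) (mset_set {..<4}) =
      {#int e + 1, int e + 2, int e + 3, int e + 4#}"
    by (simp add: eval_nat_numeral lessThan_Suc add_mset_commute add.commute)
  also have "{int e + 1..int (e + 4)} = {int e + 1, int e + 2, int e + 3, int e + 4}" by auto
  then have "{#int e + 1, int e + 2, int e + 3, int e + 4#} = mset_set {int e + 1..int (e + 4)}"
    by simp
  finally have diffs: "image_mset (\<lambda>j. \<bar>?p j - ?p (Suc j)\<bar>) (mset_set {..<4}) =
      mset_set {int e + 1..int (e + 4)}" .
  show ?thesis
    using end_at_one_extend_path[OF assms _ _ _ _ _ verts diffs] by auto
qed

text \<open>Every move leaves a good labeling, so moves can be iterated; their difference intervals
  are consecutive and concatenate.\<close>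

lemma end_at_one_extend:
  assumes f: "end_at_one f L m e P" and n: "n = 3 * x + 4 * y"
  shows "\<exists>f'. end_at_one f' L (m + n) (e + n) (P + mset_set {int e + 1..int (e + n)})"
proof -
  define Q where "Q n \<longleftrightarrow>
    (\<exists>f'. end_at_one f' L (m + n) (e + n) (P + mset_set {int e + 1..int (e + n)}))" for n
  have step: "Q (n + d)" if "Q n" "d = 3 \<or> d = 4" for n d
  proof -
    from \<open>Q n\<close> obtain f'
      where f': "end_at_one f' L (m + n) (e + n) (P + mset_set {int e + 1..int (e + n)})"
      by (auto simp: Q_def)
    have "mset_set {int e + 1..int (e + n)} + mset_set {int (e + n) + 1..int (e + n + d)} =
        mset_set {int e + 1..int (e + n + d)}"
      by (rule mset_set_ivl_append) auto
    with end_at_one_extend3[OF f'] end_at_one_extend4[OF f'] that(2) show "Q (n + d)"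
      unfolding Q_def by (auto simp only: add.assoc)
  qed
  have "Q (4 * y)"
  proof (induction y)
    case 0
    with f show ?case by (auto simp: Q_def)
  next
    case (Suc y)
    then show ?case using step[of "4 * y" 4] by (simp add: add.commute)
  qed
  then have "Q (3 * x + 4 * y)"
  proof (induction x)
    case 0
    then show ?case by simp
  next
    case (Suc x)
    then show ?case using step[of "3 * x + 4 * y" 3] by (simp add: algebra_simps)
  qed
  with n show ?thesis by (simp add: Q_def)
qed

section \<open>Adding a cycle\<close>

text \<open>The new vertices for a cycle of length \<open>2(n + 1)\<close>: the path continues from its old end 1
  along \<open>weave_path e 1, \<dots>, weave_path e n\<close>, and the cycle runs through
  \<open>weave_left e 0, \<dots>, weave_left e (n + 1), weave_right e n, \<dots>, weave_right e 1\<close>;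
  note \<open>weave_right e 0 = weave_left e 0 = -1\<close>.\<close>

definition weave_path :: "int \<Rightarrow> nat \<Rightarrow> int" where
  "weave_path e k = (if k = 0 then 1 else if even k then - 3 * int (k div 2)
     else e + 2 + 3 * int (k div 2))"

definition weave_left :: "int \<Rightarrow> nat \<Rightarrow> int" where
  "weave_left e k = (if k = 0 then -1 else if even k then 1 - 3 * int (k div 2)
     else e + 1 + 3 * int (k div 2))"

definition weave_right :: "int \<Rightarrow> nat \<Rightarrow> int" where
  "weave_right e k = (if even k then -1 - 3 * int (k div 2) else e + 3 + 3 * int (k div 2))"

lemmas weave_defs = weave_path_def weave_left_def weave_right_def

text \<open>Passing from \<open>n\<close> to \<open>n + 1\<close> adds one vertex to each of the
  three strands: one low and two high labels if \<open>n\<close> is even, two low and one high if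
  \<open>n\<close> is odd. The quotients by 2 express both parities at once. The two common ends of
  the cycle halves are counted with \<open>weave_left\<close>.\<close>

lemma weave_verts:
  fixes e :: int
  assumes "1 \<le> n" and e: "0 \<le> e"
  shows "image_mset (weave_left e) (mset_set {..Suc n}) +
      image_mset (weave_right e) (mset_set {Suc 0..n}) +
      image_mset (weave_path e) (mset_set {Suc 0..n}) =
    mset_set {- ((3 * int n + 2) div 2)..-1} + mset_set {e + 1..e + (3 * int n + 3) div 2}"
  using assms(1)
proof (induction n rule: dec_induct)
  case base
  have "{e + 1..e + 3} = {e + 1, e + 2, e + 3}" "{-2..-1::int} = {-2, -1}" by auto
  then show ?case
    by (simp add: weave_defs atMost_Suc add_mset_commute add.commute)
next
  case (step n)
  have *: "{..Suc (Suc n)} = insert (Suc (Suc n)) {..Suc n}" "{Suc 0..Suc n} = insert (Suc n) {Suc 0..n}"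
    using step(1) by auto
  let ?I = "mset_set {- ((3 * int n + 2) div 2)..-1} + mset_set {e + 1..e + (3 * int n + 3) div 2}"
  let ?new = "{#weave_left e (Suc (Suc n)), weave_right e (Suc n), weave_path e (Suc n)#}"
  have "?I + ?new =
    mset_set {- ((3 * int (Suc n) + 2) div 2)..-1} + mset_set {e + 1..e + (3 * int (Suc n) + 3) div 2}"
  proof (cases "even n")
    case True
    then obtain q where n: "n = 2 * q" by blast
    have "mset_set {- (3 * int q + 2)..-1} = add_mset (- (3 * int q + 2)) (mset_set {- (3 * int q + 1)..-1})"
      by (rule mset_set_ivl_cons) auto
    moreover have "mset_set {e + 1..e + (3 * int q + 3)} =
        add_mset (e + (3 * int q + 3)) (mset_set {e + 1..e + (3 * int q + 2)})"
      "mset_set {e + 1..e + (3 * int q + 2)} =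
        add_mset (e + (3 * int q + 2)) (mset_set {e + 1..e + (3 * int q + 1)})"
      using e by (intro mset_set_ivl_snoc; simp)+
    moreover have "(3 * int n + 2) div 2 = 3 * int q + 1" "(3 * int n + 3) div 2 = 3 * int q + 1"
      "(3 * int (Suc n) + 2) div 2 = 3 * int q + 2" "(3 * int (Suc n) + 3) div 2 = 3 * int q + 3"
      by (simp_all add: n)
    moreover have "weave_left e (Suc (Suc n)) = - (3 * int q + 2)"
      "weave_right e (Suc n) = e + (3 * int q + 3)" "weave_path e (Suc n) = e + (3 * int q + 2)"
      by (simp_all add: weave_defs n)
    ultimately show ?thesis
      by (simp only: union_mset_add_mset_left union_mset_add_mset_right add_0_right add_mset_commute)
  next
    case False
    then obtain q where n: "n = Suc (2 * q)" by (auto elim: oddE)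
    have "mset_set {- (3 * int q + 4)..-1} = add_mset (- (3 * int q + 4)) (mset_set {- (3 * int q + 3)..-1})"
      "mset_set {- (3 * int q + 3)..-1} = add_mset (- (3 * int q + 3)) (mset_set {- (3 * int q + 2)..-1})"
      by (rule mset_set_ivl_cons; simp)+
    moreover have "mset_set {e + 1..e + (3 * int q + 4)} =
        add_mset (e + (3 * int q + 4)) (mset_set {e + 1..e + (3 * int q + 3)})"
      using e by (intro mset_set_ivl_snoc; simp)+
    moreover have "(3 * int n + 2) div 2 = 3 * int q + 2" "(3 * int n + 3) div 2 = 3 * int q + 3"
      "(3 * int (Suc n) + 2) div 2 = 3 * int q + 4" "(3 * int (Suc n) + 3) div 2 = 3 * int q + 4"
      by (simp_all add: n)
    moreover have "weave_left e (Suc (Suc n)) = e + (3 * int q + 4)"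
      "weave_right e (Suc n) = - (3 * int q + 4)" "weave_path e (Suc n) = - (3 * int q + 3)"
      by (simp_all add: weave_defs n)
    ultimately show ?thesis
      by (simp only: union_mset_add_mset_left union_mset_add_mset_right add_0_right add_mset_commute)
  qed
  then show ?case
    using step.IH unfolding * by (simp add: add_mset_commute)
qed

text \<open>Step \<open>k\<close> of the strands has difference \<open>e + 3k\<close> on the left,
  \<open>e + 3k + 4\<close> on the right and \<open>e + 3k + 2\<close> on the path, except that at
  \<open>k = 0\<close> the left has \<open>e + 2\<close> and the path \<open>e + 1\<close>. The edge
  that joins the right strand to the last left vertex is not included here.\<close>

lemma weave_diffs:
  fixes e :: int
  assumes "1 \<le> n" and e: "0 \<le> e"
  shows "image_mset (\<lambda>k. \<bar>weave_left e k - weave_left e (Suc k)\<bar>) (mset_set {..<Suc n}) +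
      image_mset (\<lambda>k. \<bar>weave_right e (Suc k) - weave_right e k\<bar>) (mset_set {..<n}) +
      image_mset (\<lambda>k. \<bar>weave_path e k - weave_path e (Suc k)\<bar>) (mset_set {..<n}) =
    mset_set {e + 1..e + 3 * int n + 1}" (is "?S n = _")
  using assms(1)
proof (induction n rule: dec_induct)
  case base
  have "{e + 1..e + 4} = {e + 1, e + 2, e + 3, e + 4}" by auto
  with e show ?case
    by (simp add: weave_defs lessThan_Suc add_mset_commute add.commute)
next
  case (step n)
  have "?S (Suc n) = ?S n + {#\<bar>weave_path e n - weave_path e (Suc n)\<bar>,
      \<bar>weave_left e (Suc n) - weave_left e (Suc (Suc n))\<bar>,
      \<bar>weave_right e (Suc n) - weave_right e n\<bar>#}"
    by (simp add: lessThan_Suc add_mset_commute)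
  \<comment> \<open>Here \<open>1 \<le> n\<close> matters: \<open>weave_path e 0\<close> is the old
    path end 1, where the general formula would give 0.\<close>
  also have "\<bar>weave_path e n - weave_path e (Suc n)\<bar> = e + 3 * int n + 2"
    using step(1) e by (cases "even n"; auto simp: weave_defs elim!: evenE oddE)
  also have "\<bar>weave_left e (Suc n) - weave_left e (Suc (Suc n))\<bar> = e + 3 * int n + 3"
    using e by (cases "even n"; auto simp: weave_defs elim!: evenE oddE)
  also have "\<bar>weave_right e (Suc n) - weave_right e n\<bar> = e + 3 * int n + 4"
    using e by (cases "even n"; auto simp: weave_defs elim!: evenE oddE)
  also have "{#e + 3 * int n + 2, e + 3 * int n + 3, e + 3 * int n + 4#} =
      mset_set {e + 3 * int n + 2..e + 3 * int n + 4}"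
    by (simp add: mset_set_ivl_cons[of "e + 3 * int n + 3"] mset_set_ivl_cons[of "e + 3 * int n + 4"])
  also have "?S n + mset_set {e + 3 * int n + 2..e + 3 * int n + 4} =
      mset_set {e + 1..e + 3 * int n + 4}"
    unfolding step.IH using e by (intro mset_set_ivl_append) auto
  finally show ?case
    by (simp add: algebra_simps)
qed

section \<open>Cycles glued from two paths\<close>

lemma mset_set_split_reversed:
  fixes h :: nat
  shows "mset_set {..<2 * h} = mset_set {..<h} + image_mset (\<lambda>k. 2 * h - 1 - k) (mset_set {..<h})"
proof -
  have "bij_betw (\<lambda>k. 2 * h - 1 - k) {..<h} {h..<2 * h}"
    by (rule bij_betw_byWitness[where f' = "\<lambda>k. 2 * h - 1 - k"]) auto
  then have "image_mset (\<lambda>k. 2 * h - 1 - k) (mset_set {..<h}) = mset_set {h..<2 * h}"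
    by (metis bij_betw_def image_mset_mset_set)
  moreover have "mset_set ({..<h} \<union> {h..<2 * h}) = mset_set {..<h} + mset_set {h..<2 * h}"
    by (rule mset_set_Union) auto
  moreover have "{..<2 * h} = {..<h} \<union> {h..<2 * h}" by auto
  ultimately show ?thesis by simp
qed

text \<open>The cycle climbs along \<open>a\<close> and returns along \<open>b\<close>, so reversing
  the second half of the indices turns the return into a walk up \<open>b\<close>. Each shared end
  is counted once: the common start with \<open>a\<close>, the common top with
  \<open>b\<close>.\<close>

lemma cycle_of_two_paths:
  assumes "a 0 = b 0" "a h = b h"
  defines "C \<equiv> \<lambda>j. if j \<le> h then a j else b (2 * h - j)"
  shows "image_mset C (mset_set {..<2 * h}) =
      image_mset a (mset_set {..<h}) + image_mset b (mset_set {Suc 0..h})"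
    and "image_mset (\<lambda>j. g (C j) (C (Suc j mod (2 * h)))) (mset_set {..<2 * h}) =
      image_mset (\<lambda>k. g (a k) (a (Suc k))) (mset_set {..<h}) +
      image_mset (\<lambda>k. g (b (Suc k)) (b k)) (mset_set {..<h})"
proof -
  have right: "C (2 * h - 1 - k) = b (Suc k)" if "k < h" for k
  proof (cases "Suc k = h")
    case True
    then show ?thesis using assms(2) by (auto simp: C_def)
  next
    case False
    with that have "\<not> 2 * h - 1 - k \<le> h" "2 * h - (2 * h - 1 - k) = Suc k" by auto
    then show ?thesis by (simp add: C_def)
  qed
  \<comment> \<open>The index wraps round only for \<open>k = 0\<close>, where it returns to
    \<open>C 0 = a 0 = b 0\<close>.\<close>
  have right': "C (Suc (2 * h - 1 - k) mod (2 * h)) = b k" if "k < h" for k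
  proof (cases k)
    case 0
    with that assms(1) show ?thesis by (simp add: C_def)
  next
    case (Suc i)
    with that have "Suc (2 * h - 1 - k) mod (2 * h) = 2 * h - k" "\<not> 2 * h - k \<le> h" by auto
    with that show ?thesis by (simp add: C_def)
  qed
  have Suc: "mset_set {Suc 0..h} = image_mset Suc (mset_set {..<h})"
    by (simp add: image_mset_mset_set image_Suc_lessThan)
  show "image_mset C (mset_set {..<2 * h}) =
      image_mset a (mset_set {..<h}) + image_mset b (mset_set {Suc 0..h})"
    unfolding mset_set_split_reversed Suc image_mset_union multiset.map_comp o_def
    by (intro arg_cong2[where f = "(+)"] image_mset_cong) (use right in \<open>auto simp: C_def\<close>)
  show "image_mset (\<lambda>j. g (C j) (C (Suc j mod (2 * h)))) (mset_set {..<2 * h}) =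
      image_mset (\<lambda>k. g (a k) (a (Suc k))) (mset_set {..<h}) +
      image_mset (\<lambda>k. g (b (Suc k)) (b k)) (mset_set {..<h})"
    unfolding mset_set_split_reversed image_mset_union multiset.map_comp o_def
    by (intro arg_cong2[where f = "(+)"] image_mset_cong) (use right right' in \<open>auto simp: C_def\<close>)
qed

lemma end_at_one_add_cycle:
  assumes f: "end_at_one f L m e P" and n: "1 \<le> n"
  obtains f' P' where "end_at_one f' (add_mset (2 * Suc n) L) (m + n) (e + 3 * n + 2) P'"
proof -
  \<comment> \<open>The right strand is closed at the top by the last left vertex, so that both
    strands have the same ends.\<close>
  define b where "b k = (if k = Suc n then weave_left e k else weave_right e k)" for k
  define C where "C j = (if j \<le> Suc n then weave_left e j else b (2 * Suc n - j))" for j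
  let ?p = "weave_path e"
  let ?e = "e + 3 * n + 2"
  let ?A = "(3 * int n + 2) div 2" and ?B = "int e + (3 * int n + 3) div 2"
  note cycle = cycle_of_two_paths[of "weave_left e" b "Suc n", folded C_def]
  have ends: "weave_left e 0 = b 0" "weave_left e (Suc n) = b (Suc n)"
    by (simp_all add: b_def weave_defs)
  have bs: "image_mset b (mset_set {Suc 0..n}) = image_mset (weave_right e) (mset_set {Suc 0..n})"
    "image_mset (\<lambda>k. \<bar>b (Suc k) - b k\<bar>) (mset_set {..<n}) =
      image_mset (\<lambda>k. \<bar>weave_right e (Suc k) - weave_right e k\<bar>) (mset_set {..<n})"
    by (auto simp: b_def intro!: image_mset_cong)
  have "image_mset C (mset_set {..<2 * Suc n}) =
      image_mset (weave_left e) (mset_set {..Suc n}) +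
      image_mset (weave_right e) (mset_set {Suc 0..n})"
    unfolding cycle(1)[OF ends] bs(1)[symmetric]
    by (simp add: lessThan_Suc_atMost atLeastAtMostSuc_conv atMost_Suc b_def)
  then have verts: "image_mset C (mset_set {..<2 * Suc n}) + image_mset ?p (mset_set {Suc 0..n}) =
      mset_set {- ?A..-1} + mset_set {int e + 1..?B}"
    using weave_verts[OF n, of e] by simp
  \<comment> \<open>This is the edge left out of \<open>weave_diffs\<close>; its difference is
    exactly the next one after those listed there.\<close>
  have closing: "\<bar>b (Suc n) - b n\<bar> = e + 3 * int n + 2"
    using n by (cases "even n"; auto simp: b_def weave_defs elim!: evenE oddE)
  have "image_mset (\<lambda>j. \<bar>C j - C (Suc j mod (2 * Suc n))\<bar>) (mset_set {..<2 * Suc n}) =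
      image_mset (\<lambda>k. \<bar>weave_left e k - weave_left e (Suc k)\<bar>) (mset_set {..<Suc n}) +
      image_mset (\<lambda>k. \<bar>b (Suc k) - b k\<bar>) (mset_set {..<Suc n})"
    by (rule cycle(2)[OF ends])
  also have "image_mset (\<lambda>k. \<bar>b (Suc k) - b k\<bar>) (mset_set {..<Suc n}) =
      add_mset (e + 3 * int n + 2)
        (image_mset (\<lambda>k. \<bar>weave_right e (Suc k) - weave_right e k\<bar>) (mset_set {..<n}))"
    unfolding bs(2)[symmetric] closing[symmetric] by (simp add: lessThan_Suc)
  finally have "image_mset (\<lambda>j. \<bar>C j - C (Suc j mod (2 * Suc n))\<bar>) (mset_set {..<2 * Suc n}) +
      image_mset (\<lambda>j. \<bar>?p j - ?p (Suc j)\<bar>) (mset_set {..<n}) =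
      add_mset (e + 3 * int n + 2) (mset_set {int e + 1..int e + 3 * int n + 1})"
    using weave_diffs[OF n, of e] by simp
  also have "\<dots> = mset_set {int e + 1..int ?e}"
    using mset_set_ivl_snoc[of "int e + 1" "int e + 3 * int n + 1" "int ?e"] by (simp add: add.assoc)
  finally have diffs: "image_mset (\<lambda>j. \<bar>C j - C (Suc j mod (2 * Suc n))\<bar>) (mset_set {..<2 * Suc n}) +
      image_mset (\<lambda>j. \<bar>?p j - ?p (Suc j)\<bar>) (mset_set {..<n}) = mset_set {int e + 1..int ?e}" .
  have labels: "labels f (add_mset 2 L) m (mset_set {0..int e})
      ({#1, 3, 3#} + mset_set {4..int e}) P" and p0: "f (Pth m) = 1"
    using f unfolding end_at_one_def by metis+
  have "image_mset (\<lambda>j. \<bar>C j - C (Suc j mod (2 * Suc n))\<bar>) (mset_set {..<2 * Suc n})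
      \<subseteq># mset_set {int e + 1..int ?e}"
    unfolding diffs[symmetric] by (rule mset_subset_eq_add_left)
  then have neC: "C j \<noteq> C (Suc j mod (2 * Suc n))" if "j < 2 * Suc n" for j
    by (rule consecutive_distinct) (use that in simp)
  have "image_mset (\<lambda>j. \<bar>?p j - ?p (Suc j)\<bar>) (mset_set {..<n}) \<subseteq># mset_set {int e + 1..int ?e}"
    unfolding diffs[symmetric] by (rule mset_subset_eq_add_right)
  then have nep: "?p j \<noteq> ?p (Suc j)" if "j < n" for j
    by (rule consecutive_distinct) (use that in simp)
  obtain f1 where f1: "labels f1 (add_mset (2 * Suc n) (add_mset 2 L)) m
      (mset_set {0..int e} + image_mset C (mset_set {..<2 * Suc n}))
      ({#1, 3, 3#} + mset_set {4..int e} +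
        image_mset (\<lambda>j. \<bar>C j - C (Suc j mod (2 * Suc n))\<bar>) (mset_set {..<2 * Suc n})) P"
    "\<And>j. f1 (Pth j) = f (Pth j)"
    using labels_add_cycle[where l = "2 * Suc n" and C = C, OF labels neC] by blast
  have p0': "?p 0 = f1 (Pth m)"
    by (simp add: f1(2) p0 weave_path_def)
  obtain f' P' where f': "labels f' (add_mset (2 * Suc n) (add_mset 2 L)) (m + n)
      (mset_set {0..int e} + (mset_set {- ?A..-1} + mset_set {int e + 1..?B}))
      ({#1, 3, 3#} + mset_set {4..int e} + mset_set {int e + 1..int ?e}) P'"
    "f' (Pth (m + n)) = ?p n"
    using labels_extend_path[where t = n, OF f1(1) p0' nep] unfolding add.assoc verts diffs by blast
  have f'': "labels f' (add_mset 2 (add_mset (2 * Suc n) L)) (m + n)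
      (mset_set {0..int e} + (mset_set {- ?A..-1} + mset_set {int e + 1..?B}))
      ({#1, 3, 3#} + mset_set {4..int e} + mset_set {int e + 1..int ?e}) P'"
    using f'(1) by (simp only: add_mset_commute)
  show ?thesis
  proof (rule end_at_one_normalize[OF f''])
    show "3 \<le> e" "?e = sum_mset (add_mset (2 * Suc n) L) + 2 + (m + n)"
      using f by (simp_all add: end_at_one_def)
    show "int ?e = ?A + ?B"
      by simp
    \<comment> \<open>For even \<open>n\<close> the path ends low, at \<open>1 - ?A\<close>; for odd
      \<open>n\<close> it ends high, at \<open>?B - 1\<close>.\<close>
    show "f' (Pth (m + n)) = 1 - ?A \<or> f' (Pth (m + n)) = ?B - 1"
      unfolding f'(2) using n by (cases "even n"; auto simp: weave_path_def elim!: evenE oddE)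
  qed (use that in auto)
qed

section \<open>Assembling all cycles and the final path\<close>

lemma exists_end_at_one:
  assumes "\<And>l. l \<in># L \<Longrightarrow> even l \<and> 2 < l \<and> l \<le> M"
  shows "\<exists>f m e P. end_at_one f L m e P \<and> e \<le> 3 + 2 * size L * M"
  using assms
proof (induction L)
  case empty
  obtain f P where "end_at_one f {#} 1 3 P" by (rule end_at_one_start)
  then show ?case by fastforce
next
  case (add l L)
  then obtain f m e P where f: "end_at_one f L m e P" and e: "e \<le> 3 + 2 * size L * M"
    by auto
  from add.prems[of l] obtain h where h: "l = 2 * h" "2 < l" "l \<le> M" by auto
  define n where "n = h - 1"
  \<comment> \<open>The increase \<open>3 * n + 2\<close> of \<open>e\<close> is less than
    \<open>2 * l = 4 * n + 4\<close>, which is at most \<open>2 * M\<close>. The bound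
    \<open>M\<close> is fixed for the whole induction, unlike the maximum of the growing
    multiset.\<close>
  have n: "1 \<le> n" "l = 2 * Suc n" "3 * n + 2 \<le> 2 * M"
    using h by (auto simp: n_def)
  obtain f' P' where "end_at_one f' (add_mset l L) (m + n) (e + 3 * n + 2) P'"
    using end_at_one_add_cycle[OF f n(1)] unfolding n(2) by blast
  moreover have "e + 3 * n + 2 \<le> 3 + 2 * size (add_mset l L) * M"
    using e n(3) by (simp add: algebra_simps)
  ultimately show ?case by blast
qed

theorem theorem5p2:
  fixes L :: "nat multiset" and \<epsilon> m :: nat
  assumes "\<And>l. l \<in># L \<Longrightarrow> even l \<and> l > 2"
    and "\<epsilon> \<ge> (2 * size L + 3) * (max_or_0 L + 3)"
    and "m = \<epsilon> - sum_mset L - 2"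
  shows "\<exists>\<Gamma> f. graceful_labeling f (cycles_path (add_mset 2 L) m) \<Gamma> \<and>
    mset_set {int ((2 * size L + 1) * (max_or_0 L + 3) + 1)..int \<epsilon>} \<subseteq># Delta_path f m"
proof -
  let ?M = "max_or_0 L"
  let ?D = "(2 * size L + 1) * (?M + 3)"
  have "l \<le> ?M" if "l \<in># L" for l
    using that by (auto simp: max_or_0_def)
  then obtain f0 m0 e P where f0: "end_at_one f0 L m0 e P" and "e \<le> 3 + 2 * size L * ?M"
    using exists_end_at_one[of L ?M] assms(1) by blast
  \<comment> \<open>The assumed lower bound for \<epsilon> exceeds \<open>?D\<close> by
    \<open>2 * (?M + 3)\<close>, which is at least 6.\<close>
  then have e: "e \<le> ?D" "e + 6 \<le> \<epsilon>"
    using assms(2) by (auto simp: algebra_simps)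
  define n where "n = \<epsilon> - e"
  have n: "6 \<le> n" "e + n = \<epsilon>" using e by (auto simp: n_def)
  have "\<exists>x y. n = 3 * x + 4 * y" using n(1) by presburger
  then obtain f where "end_at_one f L (m0 + n) (e + n) (P + mset_set {int e + 1..int (e + n)})"
    using end_at_one_extend[OF f0] by blast
  \<comment> \<open>The truncated subtraction defining \<open>m\<close> is exact, since
    \<open>\<epsilon> = sum_mset L + 2 + (m0 + n)\<close>.\<close>
  moreover from this have "m0 + n = m"
    using assms(3) n(2) by (simp add: end_at_one_def)
  ultimately have f: "end_at_one f L m \<epsilon> (P + mset_set {int e + 1..int \<epsilon>})"
    by (simp only: n(2))
  let ?G = "cycles_path (add_mset 2 L) m"
  let ?\<Gamma> = "\<lparr>verts = {0..int \<epsilon>}, edges = image_mset (image f) (edges ?G)\<rparr>"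
  have labels: "labels f (add_mset 2 L) m (mset_set {0..int \<epsilon>}) ({#1, 3, 3#} + mset_set {4..int \<epsilon>})
      (P + mset_set {int e + 1..int \<epsilon>})" and \<epsilon>: "\<epsilon> = sum_mset L + 2 + m"
    using f unfolding end_at_one_def by metis+
  have "size (edges ?G) = \<epsilon>"
    using \<epsilon> by (simp add: size_edges)
  moreover have "bij_betw f (verts ?G) {0..int \<epsilon>}"
    using labels by (intro bij_betw_if_image_mset) (auto simp: labels_def finite_verts)
  ultimately have "graceful_labeling f ?G ?\<Gamma>"
    using labels unfolding graceful_labeling_def isomorphism_def labels_def plus_minus_add by simp
  moreover have "mset_set {int (?D + 1)..int \<epsilon>} \<subseteq># mset_set {int e + 1..int \<epsilon>}"
  proof (rule subset_imp_msubset_mset_set)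
    show "{int (?D + 1)..int \<epsilon>} \<subseteq> {int e + 1..int \<epsilon>}"
      using e(1) by (intro atLeastatMost_subset_iff[THEN iffD2]) linarith
  qed simp
  \<comment> \<open>All differences beyond \<open>e\<close> were put on the path in the last
    extension; they form part of the unnegated half of \<open>plus_minus\<close>.\<close>
  moreover have "mset_set {int e + 1..int \<epsilon>} \<subseteq># plus_minus (P + mset_set {int e + 1..int \<epsilon>})"
    by (simp add: plus_minus_def subset_mset.add_increasing2)
  then have "mset_set {int e + 1..int \<epsilon>} \<subseteq># Delta_path f m"
    using labels by (simp only: labels_def)
  ultimately show ?thesis
    by (meson subset_mset.order_trans)
qed

end
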